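(* The following hold. (1) For all $i\in\{1,\dots,N\}$ and all $v\in V_0$, $\langle \phi_i,v\rangle=0$. (2) For all real numbers $w_1,\dots,w_N$, the function $\sum_{i=1}^N w_i\phi_i$ is the unique minimizer of $\langle w,w\rangle=\int_\Omega(\operatorname{div}(a\nabla w))^2$ over all $w\in V$ such that $w(x_i)=w_i$ for all $i\in\{1,\dots,N\}$. (3) For all $i\in\{1,\dots,N\}$ and all $v\in V$, $\langle\phi_i,v\rangle=\sum_{j=1}^N P_{i,j}\,v(x_j)$. (4) For all $i,j\in\{1,\dots,N\}$, $\langle\phi_i,\phi_j\rangle=P_{i,j}$.
   Context: Setting: $d\leq 3$; $\Omega\subset\mathbb{R}^d$ is a bounded domain with piecewise Lipschitz boundary satisfying an interior cone condition; $a$ is a symmetric-matrix-valued function on $\Omega$ with entries in $L^\infty(\Omega)$ such that $\lambda_{\min}(a)|\xi|^2\le \xi^T a(x)\xi\le \lambda_{\max}(a)|\xi|^2$ for all $\xi\in\mathbb{R}^d$ and almost all $x\in\Omega$, with $0<\lambda_{\min}(a)\le\lambda_{\max}(a)<\infty$. $x_1,\dots,x_N$ are finitely many distinct points of $\Omega$. $V:=\{u\in H^1_0(\Omega): \operatorname{div}(a\nabla u)\in L^2(\Omega)\}$; since $d\le 3$, elements of $V$ are (Hölder) continuous on $\Omega$, so point values make sense. $V_0:=\{v\in V: v(x_i)=0\ \forall i\}$. For $u,v\in V$, $\langle u,v\rangle:=\int_\Omega \operatorname{div}(a\nabla u)\operatorname{div}(a\nabla v)$. For each $i$, $\phi_i$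 is the (unique) minimizer of $\int_\Omega|\operatorname{div}(a\nabla\phi)|^2$ over $V_i:=\{\phi\in V:\phi(x_i)=1,\ \phi(x_j)=0 \text{ for } j\ne i\}$. $G(x,y)$ is the (symmetric) Green's function of $-\operatorname{div}(a\nabla\cdot)$ on $\Omega$ with zero Dirichlet boundary condition: $-\operatorname{div}(a\nabla G(\cdot,y))=\delta(\cdot-y)$ in $\Omega$, $G(\cdot,y)=0$ on $\partial\Omega$; i.e. for $g\in L^2(\Omega)$, the $u\in V$ with $-\operatorname{div}(a\nabla u)=g$ is $u(y)=\int_\Omega G(x,y)g(x)\,dx$. $\Theta$ is the $N\times N$ symmetric positive definite matrix $\Theta_{i,j}:=\int_\Omega G(x,x_i)G(x,x_j)\,dx$, and $P:=\Theta^{-1}$. *)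

theory Defs
  imports "HOL-Analysis.Analysis"
begin

section \<open>Domains\<close>

definition bounded_domain :: "(real^'d) set \<Rightarrow> bool" where
  "bounded_domain \<Omega> \<longleftrightarrow> open \<Omega> \<and> connected \<Omega> \<and> bounded \<Omega> \<and> \<Omega> \<noteq> {}"

text \<open>A patch is a Lipschitz graph, in rotated coordinates, over the closure of a bounded connected
  relatively open part of the hyperplane orthogonal to the unit vector \<open>e\<close>.  Neighbouring patches
  may use different directions and need not fit together to a Lipschitz graph.\<close>

definition lipschitz_patch :: "(real^'d) set \<Rightarrow> bool" where
  "lipschitz_patch \<Gamma> \<longleftrightarrow>
    (\<exists>e U \<gamma> L. norm e = 1 \<and> openin (top_of_set {y. y \<bullet> e = 0}) U \<and> connected U \<and> bounded U \<and>
       L-lipschitz_on (closure U) \<gamma> \<and> \<Gamma> = (\<lambda>y. y + \<gamma> y *\<^sub>R e) ` closure U)"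

definition piecewise_lipschitz_boundary :: "(real^'d) set \<Rightarrow> bool" where
  "piecewise_lipschitz_boundary \<Omega> \<longleftrightarrow>
    (\<exists>\<P>. finite \<P> \<and> (\<forall>\<Gamma>\<in>\<P>. lipschitz_patch \<Gamma>) \<and> frontier \<Omega> = \<Union>\<P>)"

definition interior_cone_condition :: "(real^'d) set \<Rightarrow> bool" where
  "interior_cone_condition \<Omega> \<longleftrightarrow>
    (\<exists>\<theta> r. 0 < \<theta> \<and> \<theta> < pi / 2 \<and> 0 < r \<and>
      (\<forall>x\<in>\<Omega>. \<exists>\<xi>. norm \<xi> = 1 \<and>
         {x + t *\<^sub>R y | t y. norm y = 1 \<and> cos \<theta> \<le> y \<bullet> \<xi> \<and> 0 \<le> t \<and> t \<le> r} \<subseteq> \<Omega>))"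

section \<open>Function spaces\<close>

text \<open>Elements of the spaces below are functions on the whole space of which only the values on
  \<open>\<Omega>\<close> matter; no quotient by almost everywhere equality is taken.\<close>

definition L2 :: "(real^'d) set \<Rightarrow> (real^'d \<Rightarrow> real) set" where
  "L2 \<Omega> = {f \<in> borel_measurable (lebesgue_on \<Omega>). integrable (lebesgue_on \<Omega>) (\<lambda>x. (f x)\<^sup>2)}"

definition grad :: "(real^'d \<Rightarrow> real) \<Rightarrow> real^'d \<Rightarrow> real^'d" where
  "grad f x = (\<chi> i. frechet_derivative f (at x) (axis i 1))"

primrec C_k :: "nat \<Rightarrow> (real^'d \<Rightarrow> real) \<Rightarrow> bool" where
  "C_k 0 f \<longleftrightarrow> continuous_on UNIV f"
| "C_k (Suc k) f \<longleftrightarrow> (\<forall>x. f differentiable (at x)) \<and> (\<forall>i. C_k k (\<lambda>x. grad f x $ i))"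

definition test_function :: "(real^'d) set \<Rightarrow> (real^'d \<Rightarrow> real) \<Rightarrow> bool" where
  "test_function \<Omega> \<psi> \<longleftrightarrow> (\<forall>k. C_k k \<psi>) \<and> (\<exists>K. compact K \<and> K \<subseteq> \<Omega> \<and> (\<forall>x. x \<notin> K \<longrightarrow> \<psi> x = 0))"

definition is_weak_grad :: "(real^'d) set \<Rightarrow> (real^'d \<Rightarrow> real) \<Rightarrow> (real^'d \<Rightarrow> real^'d) \<Rightarrow> bool" where
  "is_weak_grad \<Omega> u F \<longleftrightarrow>
    (\<forall>i. (\<lambda>x. F x $ i) \<in> L2 \<Omega>) \<and>
    (\<forall>\<psi> i. test_function \<Omega> \<psi> \<longrightarrow>
       (\<integral>x. u x * grad \<psi> x $ i \<partial>lebesgue_on \<Omega>) = - (\<integral>x. F x $ i * \<psi> x \<partial>lebesgue_on \<Omega>))"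

definition H1 :: "(real^'d) set \<Rightarrow> (real^'d \<Rightarrow> real) set" where
  "H1 \<Omega> = {u \<in> L2 \<Omega>. \<exists>F. is_weak_grad \<Omega> u F}"

definition weak_grad :: "(real^'d) set \<Rightarrow> (real^'d \<Rightarrow> real) \<Rightarrow> real^'d \<Rightarrow> real^'d" where
  "weak_grad \<Omega> u = (SOME F. is_weak_grad \<Omega> u F)"

text \<open>The closure of the test functions in \<open>H1 \<Omega>\<close>.\<close>

definition H10 :: "(real^'d) set \<Rightarrow> (real^'d \<Rightarrow> real) set" where
  "H10 \<Omega> = {u \<in> H1 \<Omega>. \<exists>\<psi>. (\<forall>n. test_function \<Omega> (\<psi> n)) \<and>
     (\<lambda>n::nat. (\<integral>x. (\<psi> n x - u x)\<^sup>2 \<partial>lebesgue_on \<Omega>)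
        + (\<integral>x. (norm (grad (\<psi> n) x - weak_grad \<Omega> u x))\<^sup>2 \<partial>lebesgue_on \<Omega>)) \<longlonglongrightarrow> 0}"

definition is_weak_div :: "(real^'d) set \<Rightarrow> (real^'d \<Rightarrow> real^'d) \<Rightarrow> (real^'d \<Rightarrow> real) \<Rightarrow> bool" where
  "is_weak_div \<Omega> F f \<longleftrightarrow>
    (\<forall>\<psi>. test_function \<Omega> \<psi> \<longrightarrow>
       (\<integral>x. F x \<bullet> grad \<psi> x \<partial>lebesgue_on \<Omega>) = - (\<integral>x. f x * \<psi> x \<partial>lebesgue_on \<Omega>))"

section \<open>The operator div (a grad)\<close>

definition elliptic_coefficient ::
    "(real^'d) set \<Rightarrow> (real^'d \<Rightarrow> real^'d^'d) \<Rightarrow> real \<Rightarrow> real \<Rightarrow> bool" where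
  "elliptic_coefficient \<Omega> a lmin lmax \<longleftrightarrow>
    (\<forall>i j. (\<lambda>x. a x $ i $ j) \<in> borel_measurable (lebesgue_on \<Omega>) \<and>
           (\<exists>C. AE x in lebesgue_on \<Omega>. \<bar>a x $ i $ j\<bar> \<le> C)) \<and>
    (AE x in lebesgue_on \<Omega>. transpose (a x) = a x) \<and>
    0 < lmin \<and> lmin \<le> lmax \<and>
    (AE x in lebesgue_on \<Omega>. \<forall>\<xi>. lmin * (norm \<xi>)\<^sup>2 \<le> \<xi> \<bullet> (a x *v \<xi>) \<and>
                                 \<xi> \<bullet> (a x *v \<xi>) \<le> lmax * (norm \<xi>)\<^sup>2)"

text \<open>The \<open>L2\<close> function \<open>div (a grad u)\<close>, unique up to null sets when it exists.\<close>

definition div_a_grad ::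
    "(real^'d) set \<Rightarrow> (real^'d \<Rightarrow> real^'d^'d) \<Rightarrow> (real^'d \<Rightarrow> real) \<Rightarrow> real^'d \<Rightarrow> real" where
  "div_a_grad \<Omega> a u = (SOME f. f \<in> L2 \<Omega> \<and> is_weak_div \<Omega> (\<lambda>x. a x *v weak_grad \<Omega> u x) f)"

text \<open>In dimension at most three every class in \<open>V\<close> has a unique representative that is continuous
  on \<open>\<Omega>\<close>; the elements of \<open>V\<close> are taken to be these representatives, so that point
  evaluation is function application.\<close>

definition V :: "(real^'d) set \<Rightarrow> (real^'d \<Rightarrow> real^'d^'d) \<Rightarrow> (real^'d \<Rightarrow> real) set" where
  "V \<Omega> a = {u \<in> H10 \<Omega>. continuous_on \<Omega> u \<and>
     (\<exists>f\<in>L2 \<Omega>. is_weak_div \<Omega> (\<lambda>x. a x *v weak_grad \<Omega> u x) f)}"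

definition V0 ::
    "(real^'d) set \<Rightarrow> (real^'d \<Rightarrow> real^'d^'d) \<Rightarrow> ('n \<Rightarrow> real^'d) \<Rightarrow> (real^'d \<Rightarrow> real) set" where
  "V0 \<Omega> a p = {v \<in> V \<Omega> a. \<forall>i. v (p i) = 0}"

definition V_ind ::
    "(real^'d) set \<Rightarrow> (real^'d \<Rightarrow> real^'d^'d) \<Rightarrow> ('n \<Rightarrow> real^'d) \<Rightarrow> 'n \<Rightarrow> (real^'d \<Rightarrow> real) set" where
  "V_ind \<Omega> a p i = {v \<in> V \<Omega> a. v (p i) = 1 \<and> (\<forall>j. j \<noteq> i \<longrightarrow> v (p j) = 0)}"

definition scalar_prod ::
    "(real^'d) set \<Rightarrow> (real^'d \<Rightarrow> real^'d^'d) \<Rightarrow> (real^'d \<Rightarrow> real) \<Rightarrow> (real^'d \<Rightarrow> real) \<Rightarrow> real" where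
  "scalar_prod \<Omega> a u v = (\<integral>x. div_a_grad \<Omega> a u x * div_a_grad \<Omega> a v x \<partial>lebesgue_on \<Omega>)"

section \<open>Green's function\<close>

text \<open>For rough coefficients the equation \<open>- div (a grad G(\<cdot>,y)) = \<delta>\<^sub>y\<close> with zero boundary values is
  understood through the solution operator: for each right-hand side \<open>g\<close> in \<open>L2\<close> the solution
  in \<open>V\<close> is, on \<open>\<Omega>\<close>, the function \<open>y \<mapsto> \<integral> G(x,y) g(x) dx\<close>.\<close>

definition greens_function ::
    "(real^'d) set \<Rightarrow> (real^'d \<Rightarrow> real^'d^'d) \<Rightarrow> (real^'d \<Rightarrow> real^'d \<Rightarrow> real) \<Rightarrow> bool" where
  "greens_function \<Omega> a G \<longleftrightarrow>
    (\<forall>x\<in>\<Omega>. \<forall>y\<in>\<Omega>. G x y = G y x) \<and>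
    (\<forall>y\<in>\<Omega>. (\<lambda>x. G x y) \<in> L2 \<Omega>) \<and>
    (\<forall>g\<in>L2 \<Omega>. \<forall>u.
       (u \<in> V \<Omega> a \<and> (AE x in lebesgue_on \<Omega>. - div_a_grad \<Omega> a u x = g x)) \<longleftrightarrow>
       (\<forall>y\<in>\<Omega>. u y = (\<integral>x. G x y * g x \<partial>lebesgue_on \<Omega>)))"

definition Theta ::
    "(real^'d) set \<Rightarrow> (real^'d \<Rightarrow> real^'d \<Rightarrow> real) \<Rightarrow> ('n \<Rightarrow> real^'d) \<Rightarrow> real^'n^'n" where
  "Theta \<Omega> G p = (\<chi> i j. \<integral>x. G x (p i) * G x (p j) \<partial>lebesgue_on \<Omega>)"

end

theory Submission
  imports Defs
begin

text \<open>Put \<open>L u = div (a grad u)\<close>.  The Green's function identifies \<open>V\<close> with the functions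
  \<open>y \<mapsto> \<integral> G(x,y) g(x) dx\<close>, \<open>g \<in> L2\<close>, so \<open>V\<close> is a vector space on which \<open>L\<close> is linear, and
  evaluation at \<open>y\<close> is represented by \<open>\<rho>\<^sub>y = \<integral> G(x,\<cdot>) G(x,y) dx\<close>, that is
  \<open>\<langle>\<rho>\<^sub>y, v\<rangle> = v(y)\<close>.  Hence \<open>\<Theta>\<close> is the Gram matrix of the functions \<open>\<rho>\<close> at the points
  \<open>x\<^sub>i\<close>; it is nonsingular because the \<open>\<phi>\<^sub>k\<close> separate these points.  Both \<open>\<phi>\<^sub>i\<close> (by minimality)
  and \<open>\<Sum>\<^sub>j P\<^sub>i\<^sub>j \<rho>\<^sub>j\<close> are orthogonal to \<open>V0\<close> and they take the same values at the points, so they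
  coincide.\<close>

section \<open>Square-integrable functions and the energy form\<close>

lemma L2_measurable: "f \<in> L2 \<Omega> \<Longrightarrow> f \<in> borel_measurable (lebesgue_on \<Omega>)"
  by (simp add: L2_def)

lemma L2_mult_integrable:
  assumes "f \<in> L2 \<Omega>" "g \<in> L2 \<Omega>"
  shows "integrable (lebesgue_on \<Omega>) (\<lambda>x. f x * g x)"
proof (rule Bochner_Integration.integrable_bound)
  show "integrable (lebesgue_on \<Omega>) (\<lambda>x. (f x)\<^sup>2 + (g x)\<^sup>2)"
    using assms by (simp add: L2_def)
  show "(\<lambda>x. f x * g x) \<in> borel_measurable (lebesgue_on \<Omega>)"
    using assms by (intro borel_measurable_times L2_measurable)
  have "\<bar>f x * g x\<bar> \<le> (f x)\<^sup>2 + (g x)\<^sup>2" for x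
    using sum_squares_bound[of "\<bar>f x\<bar>" "\<bar>g x\<bar>"] abs_ge_zero[of "f x * g x"]
    unfolding abs_mult power2_abs by linarith
  then show "AE x in lebesgue_on \<Omega>. norm (f x * g x) \<le> norm ((f x)\<^sup>2 + (g x)\<^sup>2)"
    by simp
qed

lemma L2_lincomb:
  assumes "f \<in> L2 \<Omega>" "g \<in> L2 \<Omega>"
  shows "(\<lambda>x. c * f x + d * g x) \<in> L2 \<Omega>"
proof -
  have "(\<lambda>x. (c * f x + d * g x)\<^sup>2)
      = (\<lambda>x. c\<^sup>2 * (f x)\<^sup>2 + d\<^sup>2 * (g x)\<^sup>2 + 2 * c * d * (f x * g x))"
    by (auto simp: power2_eq_square algebra_simps)
  moreover have "(\<lambda>x. c * f x + d * g x) \<in> borel_measurable (lebesgue_on \<Omega>)"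
    using assms by (intro borel_measurable_add borel_measurable_times borel_measurable_const L2_measurable)
  ultimately show ?thesis
    using assms L2_mult_integrable[OF assms] by (simp add: L2_def)
qed

lemma div_a_grad_in_L2:
  assumes "u \<in> V \<Omega> a"
  shows "div_a_grad \<Omega> a u \<in> L2 \<Omega>"
proof -
  have "\<exists>f. f \<in> L2 \<Omega> \<and> is_weak_div \<Omega> (\<lambda>x. a x *v weak_grad \<Omega> u x) f"
    using assms by (auto simp: V_def)
  from someI_ex[OF this] show ?thesis
    by (simp add: div_a_grad_def)
qed

lemma scalar_prod_commute: "scalar_prod \<Omega> a u v = scalar_prod \<Omega> a v u"
  by (simp add: scalar_prod_def mult.commute)

lemma scalar_prod_nonneg: "0 \<le> scalar_prod \<Omega> a u u"
  by (simp add: scalar_prod_def)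

text \<open>Degenerate case of Cauchy-Schwarz: zero energy forces
  \<open>div_a_grad \<Omega> a u\<close> to vanish almost everywhere, and with it the integrand
  against any \<open>v\<close>.\<close>

lemma scalar_prod_null:
  assumes "u \<in> V \<Omega> a" "scalar_prod \<Omega> a u u = 0"
  shows "scalar_prod \<Omega> a u v = 0"
proof -
  have "AE x in lebesgue_on \<Omega>. div_a_grad \<Omega> a u x * div_a_grad \<Omega> a u x = 0"
    using assms L2_mult_integrable[OF div_a_grad_in_L2 div_a_grad_in_L2, OF assms(1,1)]
    by (subst integral_nonneg_eq_0_iff_AE[symmetric]) (auto simp: scalar_prod_def)
  then have "AE x in lebesgue_on \<Omega>. div_a_grad \<Omega> a u x * div_a_grad \<Omega> a v x = 0"
    by eventually_elim auto
  then show ?thesis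
    unfolding scalar_prod_def by (rule integral_eq_zero_AE)
qed

lemma quadratic_nonneg_imp_linear_zero:
  fixes b c :: real
  assumes "\<And>t. 0 \<le> 2 * t * b + t\<^sup>2 * c"
  shows "b = 0"
proof (rule ccontr)
  assume "b \<noteq> 0"
  \<comment> \<open>Any positive \<open>k\<close> with \<open>c < 2 * k\<close> works, since at
    \<open>t = - b / k\<close> the quadratic equals \<open>(b / k)\<^sup>2 * (c - 2 * k)\<close>.
    The absolute value covers both signs of \<open>c\<close>.\<close>
  define k where "k = \<bar>c\<bar> + 1"
  have k: "k > 0" "c < 2 * k"
    by (auto simp: k_def)
  have "2 * (- b / k) * b + (- b / k)\<^sup>2 * c = (b / k)\<^sup>2 * (c - 2 * k)"
    using k by (simp add: field_simps power2_eq_square)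
  moreover have "(b / k)\<^sup>2 * (c - 2 * k) < 0"
    using k \<open>b \<noteq> 0\<close> by (intro mult_pos_neg) auto
  ultimately show False
    using assms[of "- b / k"] by linarith
qed

section \<open>Linear structure and point evaluation from the Green's function\<close>

locale green =
  fixes \<Omega> :: "(real^'d) set" and a :: "real^'d \<Rightarrow> real^'d^'d"
    and G :: "real^'d \<Rightarrow> real^'d \<Rightarrow> real"
  assumes green: "greens_function \<Omega> a G"
begin

abbreviation sp :: "(real^'d \<Rightarrow> real) \<Rightarrow> (real^'d \<Rightarrow> real) \<Rightarrow> real" where
  "sp \<equiv> scalar_prod \<Omega> a"

text \<open>The integrand has the shape of the solution formula at \<open>z\<close> with datum
  \<open>G x y\<close>, so \<open>riesz y\<close> solves that equation directly by
  \<open>solution_iff\<close>.\<close>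

definition riesz :: "real^'d \<Rightarrow> real^'d \<Rightarrow> real" where
  "riesz y z = (\<integral>x. G x z * G x y \<partial>lebesgue_on \<Omega>)"

lemma G_in_L2: "y \<in> \<Omega> \<Longrightarrow> (\<lambda>x. G x y) \<in> L2 \<Omega>"
  using green by (simp add: greens_function_def)

lemma solution_iff:
  assumes "g \<in> L2 \<Omega>"
  shows "u \<in> V \<Omega> a \<and> (AE x in lebesgue_on \<Omega>. - div_a_grad \<Omega> a u x = g x) \<longleftrightarrow>
    (\<forall>y\<in>\<Omega>. u y = (\<integral>x. G x y * g x \<partial>lebesgue_on \<Omega>))"
  using green assms unfolding greens_function_def by blast

lemma V_representation:
  assumes "u \<in> V \<Omega> a" "y \<in> \<Omega>"
  shows "u y = - (\<integral>x. G x y * div_a_grad \<Omega> a u x \<partial>lebesgue_on \<Omega>)"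
proof -
  have "(\<lambda>x. - div_a_grad \<Omega> a u x) \<in> L2 \<Omega>"
    using L2_lincomb[OF div_a_grad_in_L2 div_a_grad_in_L2, OF assms(1,1), of "-1" 0] by simp
  from solution_iff[OF this, of u] assms show ?thesis
    by simp
qed

text \<open>No Sobolev argument enters: by linearity of the integral the combination satisfies the
  Green formula for the combined datum, and the backward direction of \<open>solution_iff\<close>
  then yields membership in \<open>V\<close> and almost everywhere linearity together. The latter is
  needed because \<open>div_a_grad\<close> is a choice of representative.\<close>

lemma V_lincomb_aux:
  assumes u: "u \<in> V \<Omega> a" and v: "v \<in> V \<Omega> a"
  shows "(\<lambda>x. c * u x + d * v x) \<in> V \<Omega> a \<and>
    (AE x in lebesgue_on \<Omega>. - div_a_grad \<Omega> a (\<lambda>x. c * u x + d * v x) x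
       = - c * div_a_grad \<Omega> a u x + - d * div_a_grad \<Omega> a v x)"
proof (subst solution_iff)
  show "(\<lambda>x. - c * div_a_grad \<Omega> a u x + - d * div_a_grad \<Omega> a v x) \<in> L2 \<Omega>"
    by (intro L2_lincomb div_a_grad_in_L2 u v)
  show "\<forall>y\<in>\<Omega>. c * u y + d * v y =
    (\<integral>x. G x y * (- c * div_a_grad \<Omega> a u x + - d * div_a_grad \<Omega> a v x) \<partial>lebesgue_on \<Omega>)"
  proof
    fix y assume y: "y \<in> \<Omega>"
    have "(\<lambda>x. G x y * (- c * div_a_grad \<Omega> a u x + - d * div_a_grad \<Omega> a v x))
        = (\<lambda>x. (- c) * (G x y * div_a_grad \<Omega> a u x) + (- d) * (G x y * div_a_grad \<Omega> a v x))"
      by (auto simp: algebra_simps)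
    then show "c * u y + d * v y =
      (\<integral>x. G x y * (- c * div_a_grad \<Omega> a u x + - d * div_a_grad \<Omega> a v x) \<partial>lebesgue_on \<Omega>)"
      using L2_mult_integrable[OF G_in_L2[OF y] div_a_grad_in_L2[OF u]]
        L2_mult_integrable[OF G_in_L2[OF y] div_a_grad_in_L2[OF v]]
      by (simp add: V_representation[OF u y] V_representation[OF v y])
  qed
qed

lemma V_lincomb: "u \<in> V \<Omega> a \<Longrightarrow> v \<in> V \<Omega> a \<Longrightarrow> (\<lambda>x. c * u x + d * v x) \<in> V \<Omega> a"
  using V_lincomb_aux by blast

lemma sp_lincomb:
  assumes u: "u \<in> V \<Omega> a" and v: "v \<in> V \<Omega> a" and w: "w \<in> V \<Omega> a"
  shows "sp (\<lambda>x. c * u x + d * v x) w = c * sp u w + d * sp v w"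
proof -
  let ?L = "div_a_grad \<Omega> a"
  note L2 = div_a_grad_in_L2
  have "sp (\<lambda>x. c * u x + d * v x) w
      = (\<integral>x. c * (?L u x * ?L w x) + d * (?L v x * ?L w x) \<partial>lebesgue_on \<Omega>)"
    unfolding scalar_prod_def
  proof (rule integral_cong_AE)
    note [measurable] = L2[OF u, THEN L2_measurable] L2[OF v, THEN L2_measurable]
      L2[OF w, THEN L2_measurable] L2[OF V_lincomb[OF u v], THEN L2_measurable]
    show "(\<lambda>x. ?L (\<lambda>x. c * u x + d * v x) x * ?L w x) \<in> borel_measurable (lebesgue_on \<Omega>)"
      "(\<lambda>x. c * (?L u x * ?L w x) + d * (?L v x * ?L w x)) \<in> borel_measurable (lebesgue_on \<Omega>)"
      by measurable
    show "AE x in lebesgue_on \<Omega>. ?L (\<lambda>x. c * u x + d * v x) x * ?L w x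
        = c * (?L u x * ?L w x) + d * (?L v x * ?L w x)"
      using V_lincomb_aux[OF u v, of c d, THEN conjunct2]
    proof eventually_elim
      case (elim x)
      then have "?L (\<lambda>x. c * u x + d * v x) x = c * ?L u x + d * ?L v x"
        by linarith
      then show ?case
        by (simp add: algebra_simps)
    qed
  qed
  also have "\<dots> = c * sp u w + d * sp v w"
    using L2_mult_integrable[OF L2[OF u] L2[OF w]] L2_mult_integrable[OF L2[OF v] L2[OF w]]
    by (simp add: scalar_prod_def)
  finally show ?thesis .
qed

lemma zero_in_V: "(\<lambda>x. 0) \<in> V \<Omega> a"
  using solution_iff[of "\<lambda>x. 0" "\<lambda>x. 0"] by (simp add: L2_def)

lemma V_sum:
  assumes "finite I" "\<And>i. i \<in> I \<Longrightarrow> f i \<in> V \<Omega> a"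
  shows "(\<lambda>x. \<Sum>i\<in>I. c i * f i x) \<in> V \<Omega> a"
  using assms
proof (induction I)
  case empty
  then show ?case by (simp add: zero_in_V)
next
  case (insert i I)
  then show ?case
    using V_lincomb[of "f i" "\<lambda>x. \<Sum>i\<in>I. c i * f i x" "c i" 1] by simp
qed

lemma sp_sum:
  assumes "finite I" "\<And>i. i \<in> I \<Longrightarrow> f i \<in> V \<Omega> a" "w \<in> V \<Omega> a"
  shows "sp (\<lambda>x. \<Sum>i\<in>I. c i * f i x) w = (\<Sum>i\<in>I. c i * sp (f i) w)"
  using assms
proof (induction I)
  case empty
  then show ?case
    using sp_lincomb[OF zero_in_V zero_in_V, of w 0 0] by simp
next
  case (insert i I)
  then show ?case
    using sp_lincomb[of "f i" "\<lambda>x. \<Sum>i\<in>I. c i * f i x" w "c i" 1]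
      V_sum[of I f c] by simp
qed

lemma sp_add_scaled:
  assumes u: "u \<in> V \<Omega> a" and v: "v \<in> V \<Omega> a"
  shows "sp (\<lambda>x. u x + t * v x) (\<lambda>x. u x + t * v x) = sp u u + 2 * t * sp u v + t\<^sup>2 * sp v v"
proof -
  let ?w = "\<lambda>x. u x + t * v x"
  have w: "?w \<in> V \<Omega> a"
    using V_lincomb[OF u v, of 1 t] by simp
  have lin: "sp ?w z = sp u z + t * sp v z" if "z \<in> V \<Omega> a" for z
    using sp_lincomb[OF u v that, of 1 t] by simp
  have "sp ?w ?w = sp ?w u + t * sp ?w v"
    using lin[OF w] by (simp add: scalar_prod_commute)
  then show ?thesis
    using lin[OF u] lin[OF v]
    by (simp add: scalar_prod_commute[of _ _ v u] algebra_simps power2_eq_square)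
qed

lemma riesz_in_V_aux:
  assumes "y \<in> \<Omega>"
  shows "riesz y \<in> V \<Omega> a \<and> (AE x in lebesgue_on \<Omega>. - div_a_grad \<Omega> a (riesz y) x = G x y)"
  by (subst solution_iff[OF G_in_L2[OF assms]]) (simp add: riesz_def)

lemma riesz_in_V: "y \<in> \<Omega> \<Longrightarrow> riesz y \<in> V \<Omega> a"
  using riesz_in_V_aux by blast

text \<open>Almost everywhere \<open>div_a_grad\<close> of \<open>riesz y\<close> is
  \<open>- G x y\<close>, and this sign matches the one in \<open>V_representation\<close>.\<close>

lemma sp_riesz:
  assumes y: "y \<in> \<Omega>" and v: "v \<in> V \<Omega> a"
  shows "sp (riesz y) v = v y"
proof -
  note [measurable] = G_in_L2[OF y, THEN L2_measurable]
    div_a_grad_in_L2[OF v, THEN L2_measurable]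
    div_a_grad_in_L2[OF riesz_in_V[OF y], THEN L2_measurable]
  have "sp (riesz y) v = (\<integral>x. - (G x y * div_a_grad \<Omega> a v x) \<partial>lebesgue_on \<Omega>)"
    unfolding scalar_prod_def
  proof (rule integral_cong_AE)
    show "AE x in lebesgue_on \<Omega>. div_a_grad \<Omega> a (riesz y) x * div_a_grad \<Omega> a v x
        = - (G x y * div_a_grad \<Omega> a v x)"
      using riesz_in_V_aux[OF y, THEN conjunct2]
    proof eventually_elim
      case (elim x)
      then have "div_a_grad \<Omega> a (riesz y) x = - G x y"
        by linarith
      then show ?case
        by simp
    qed
  qed measurable
  then show ?thesis
    by (simp add: V_representation[OF v y])
qed

text \<open>Pairing with the representer of \<open>y\<close> upgrades an almost everywhere statement
  to a value at each point of \<Omega>.\<close>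

lemma sp_definite:
  assumes "u \<in> V \<Omega> a" "sp u u = 0" "y \<in> \<Omega>"
  shows "u y = 0"
  using sp_riesz[OF assms(3,1)] scalar_prod_null[OF assms(1,2), of "riesz y"]
  by (simp add: scalar_prod_commute)

text \<open>First variation: \<open>v\<close> vanishes at all the points, so \<open>u + t v\<close>
  stays admissible for every real \<open>t\<close>, and minimality makes a quadratic in
  \<open>t\<close> without constant term nonnegative.\<close>

lemma minimizer_orthogonal:
  assumes min: "is_arg_min (\<lambda>v. sp v v) (\<lambda>v. v \<in> V_ind \<Omega> a p i) u" and v: "v \<in> V0 \<Omega> a p"
  shows "sp u v = 0"
proof (rule quadratic_nonneg_imp_linear_zero)
  fix t
  have u: "u \<in> V_ind \<Omega> a p i"
    using min by (simp add: is_arg_min_def)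
  have uV: "u \<in> V \<Omega> a" and vV: "v \<in> V \<Omega> a"
    using u v by (auto simp: V_ind_def V0_def)
  have "(\<lambda>x. u x + t * v x) \<in> V_ind \<Omega> a p i"
    using u v V_lincomb[OF uV vV, of 1 t] by (simp add: V_ind_def V0_def)
  then have "sp u u \<le> sp (\<lambda>x. u x + t * v x) (\<lambda>x. u x + t * v x)"
    using min by (auto simp: is_arg_min_def not_less)
  then show "0 \<le> 2 * t * sp u v + t\<^sup>2 * sp v v"
    unfolding sp_add_scaled[OF uV vV] by linarith
qed

end

section \<open>Gram matrix, representation of the minimizers, and interpolation\<close>

theorem theorem2p5:
  fixes \<Omega> :: "(real^'d) set"
    and a :: "real^'d \<Rightarrow> real^'d^'d"
    and lmin lmax :: real
    and p :: "'n::finite \<Rightarrow> real^'d"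
    and \<phi> :: "'n \<Rightarrow> real^'d \<Rightarrow> real"
    and G :: "real^'d \<Rightarrow> real^'d \<Rightarrow> real"
    and P :: "real^'n^'n"
  assumes "CARD('d) \<le> 3"
    and "bounded_domain \<Omega>"
    and "piecewise_lipschitz_boundary \<Omega>"
    and "interior_cone_condition \<Omega>"
    and "elliptic_coefficient \<Omega> a lmin lmax"
    and "inj p" and "range p \<subseteq> \<Omega>"
    and "\<And>i. is_arg_min (\<lambda>v. scalar_prod \<Omega> a v v) (\<lambda>v. v \<in> V_ind \<Omega> a p i) (\<phi> i)"
    and "greens_function \<Omega> a G"
    and "P = matrix_inv (Theta \<Omega> G p)"
  shows "(\<forall>i. \<forall>v\<in>V0 \<Omega> a p. scalar_prod \<Omega> a (\<phi> i) v = 0) \<and>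
    (\<forall>w :: 'n \<Rightarrow> real.
       is_arg_min (\<lambda>v. scalar_prod \<Omega> a v v) (\<lambda>v. v \<in> V \<Omega> a \<and> (\<forall>i. v (p i) = w i))
         (\<lambda>x. \<Sum>i\<in>UNIV. w i * \<phi> i x) \<and>
       (\<forall>u. is_arg_min (\<lambda>v. scalar_prod \<Omega> a v v) (\<lambda>v. v \<in> V \<Omega> a \<and> (\<forall>i. v (p i) = w i)) u \<longrightarrow>
         (\<forall>x\<in>\<Omega>. u x = (\<Sum>i\<in>UNIV. w i * \<phi> i x)))) \<and>
    (\<forall>i. \<forall>v\<in>V \<Omega> a. scalar_prod \<Omega> a (\<phi> i) v = (\<Sum>j\<in>UNIV. P $ i $ j * v (p j))) \<and>
    (\<forall>i j. scalar_prod \<Omega> a (\<phi> i) (\<phi> j) = P $ i $ j)"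
proof -
  interpret green \<Omega> a G
    by standard fact
  have p\<Omega>: "p i \<in> \<Omega>" for i
    using assms(7) by auto
  note min = assms(8)
  have \<phi>_ind: "\<phi> i \<in> V_ind \<Omega> a p i" for i
    using min[of i] by (simp add: is_arg_min_def)
  have \<phi>V: "\<phi> i \<in> V \<Omega> a" and \<phi>p: "\<phi> i (p j) = (if i = j then 1 else 0)" for i j
    using \<phi>_ind[of i] by (auto simp: V_ind_def)
  have V0p: "v (p i) = 0" if "v \<in> V0 \<Omega> a p" for v i
    using that by (simp add: V0_def)
  note orth = minimizer_orthogonal[OF min]

  let ?\<Theta> = "Theta \<Omega> G p"
  let ?r = "\<lambda>i. riesz (p i)"
  have rV: "?r i \<in> V \<Omega> a" for i
    using riesz_in_V p\<Omega> by blast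
  \<comment> \<open>Both index orders are kept: the first evaluates \<open>?\<Theta> *v c\<close>,
    the second the product of \<open>P\<close> with \<open>?\<Theta>\<close>.\<close>
  have \<Theta>: "?\<Theta> $ i $ j = ?r j (p i)" for i j
    by (simp add: Theta_def riesz_def)
  have \<Theta>': "?\<Theta> $ i $ j = ?r i (p j)" for i j
    by (simp add: Theta_def riesz_def mult.commute)
  \<comment> \<open>A kernel vector gives a combination of representers vanishing at all the points.
    By the reproducing property its energy is zero, so it pairs to zero with
    \<open>\<phi> k\<close>; that pairing is exactly \<open>c $ k\<close>.\<close>
  have "c = 0" if c: "?\<Theta> *v c = 0" for c
  proof (rule vec_eq_iff[THEN iffD2], rule allI)
    fix k
    let ?d = "\<lambda>x. \<Sum>j\<in>UNIV. c $ j * ?r j x"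
    have dV: "?d \<in> V \<Omega> a"
      by (intro V_sum rV) simp
    have sp_d: "sp ?d v = (\<Sum>j\<in>UNIV. c $ j * v (p j))" if "v \<in> V \<Omega> a" for v
      using that by (subst sp_sum) (auto simp: rV sp_riesz p\<Omega>)
    have "?d (p i) = (?\<Theta> *v c) $ i" for i
      by (simp add: matrix_vector_mult_def \<Theta> mult.commute)
    then have "sp ?d ?d = 0"
      using sp_d[OF dV] c by simp
    then have "sp ?d (\<phi> k) = 0"
      by (rule scalar_prod_null[OF dV])
    then show "c $ k = 0 $ k"
      by (simp add: sp_d[OF \<phi>V] \<phi>p if_distrib cong: if_cong)
  qed
  then have "invertible ?\<Theta>"
    by (simp add: invertible_left_inverse matrix_left_invertible_ker)
  then have "P ** ?\<Theta> = mat 1"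
    unfolding invertible_def assms(10) matrix_inv_def by (rule someI2_ex) simp
  then have P\<Theta>: "(\<Sum>j\<in>UNIV. P $ i $ j * ?\<Theta> $ j $ k) = (if i = k then 1 else 0)" for i k
    by (simp add: vec_eq_iff matrix_matrix_mult_def mat_def)

  have sp_\<phi>: "sp (\<phi> i) v = (\<Sum>j\<in>UNIV. P $ i $ j * v (p j))" if v: "v \<in> V \<Omega> a" for i v
  proof -
    let ?s = "\<lambda>x. \<Sum>j\<in>UNIV. P $ i $ j * ?r j x"
    let ?e = "\<lambda>x. 1 * \<phi> i x + (-1) * ?s x"
    have sV: "?s \<in> V \<Omega> a"
      by (intro V_sum rV) simp
    have sp_s: "sp ?s v = (\<Sum>j\<in>UNIV. P $ i $ j * v (p j))" if "v \<in> V \<Omega> a" for v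
      using that by (subst sp_sum) (auto simp: rV sp_riesz p\<Omega>)
    have eV: "?e \<in> V \<Omega> a"
      by (rule V_lincomb[OF \<phi>V sV])
    have "?e (p k) = 0" for k
      using P\<Theta>[of i k] by (simp add: \<phi>p \<Theta>')
    then have e0: "?e \<in> V0 \<Omega> a p"
      using eV by (simp add: V0_def)
    have sp_e: "sp ?e w = sp (\<phi> i) w - sp ?s w" if "w \<in> V \<Omega> a" for w
      using sp_lincomb[OF \<phi>V sV that, of 1 i "-1"] by simp
    \<comment> \<open>Both terms vanish because \<open>?e\<close> lies in \<open>V0\<close>:
      \<open>\<phi> i\<close> is orthogonal to it by minimality, and \<open>?s\<close> pairs with it
      to a combination of its point values.\<close>
    have "sp ?e ?e = 0"
      unfolding sp_e[OF eV] sp_s[OF eV] orth[OF e0] using V0p[OF e0] by simp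
    then have "sp ?e v = 0"
      by (rule scalar_prod_null[OF eV])
    then show ?thesis
      using sp_e[OF v] sp_s[OF v] by simp
  qed

  have interp: "is_arg_min (\<lambda>v. sp v v) (\<lambda>v. v \<in> V \<Omega> a \<and> (\<forall>i. v (p i) = w i))
        (\<lambda>x. \<Sum>i\<in>UNIV. w i * \<phi> i x) \<and>
      (\<forall>u. is_arg_min (\<lambda>v. sp v v) (\<lambda>v. v \<in> V \<Omega> a \<and> (\<forall>i. v (p i) = w i)) u \<longrightarrow>
        (\<forall>x\<in>\<Omega>. u x = (\<Sum>i\<in>UNIV. w i * \<phi> i x)))" for w :: "'n \<Rightarrow> real"
  proof -
    let ?s = "\<lambda>x. \<Sum>i\<in>UNIV. w i * \<phi> i x"
    have sV: "?s \<in> V \<Omega> a"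
      by (intro V_sum \<phi>V) simp
    have sp: "?s (p i) = w i" for i
      by (simp add: \<phi>p if_distrib cong: if_cong)
    \<comment> \<open>Pythagoras: the difference of an admissible \<open>u\<close> and
      \<open>?s\<close> lies in \<open>V0\<close>, hence is orthogonal to every
      \<open>\<phi> i\<close> and so to \<open>?s\<close>.\<close>
    have diff: "(\<lambda>x. 1 * u x + (-1) * ?s x) \<in> V \<Omega> a"
        "sp u u = sp ?s ?s + sp (\<lambda>x. 1 * u x + (-1) * ?s x) (\<lambda>x. 1 * u x + (-1) * ?s x)"
      if u: "u \<in> V \<Omega> a" "\<And>i. u (p i) = w i" for u
    proof -
      let ?e = "\<lambda>x. 1 * u x + (-1) * ?s x"
      show eV: "?e \<in> V \<Omega> a"
        by (rule V_lincomb[OF u(1) sV])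
      then have "?e \<in> V0 \<Omega> a p"
        using u(2) sp by (simp add: V0_def)
      then have "sp ?s ?e = 0"
        using eV by (subst sp_sum) (auto simp: \<phi>V orth)
      then show "sp u u = sp ?s ?s + sp ?e ?e"
        using sp_add_scaled[OF sV eV, of 1] by simp
    qed
    have s_min: "sp ?s ?s \<le> sp u u" if "u \<in> V \<Omega> a" "\<And>i. u (p i) = w i" for u
      using diff(2)[OF that] scalar_prod_nonneg[of \<Omega> a "\<lambda>x. 1 * u x + (-1) * ?s x"] by linarith
    \<comment> \<open>Equal minimal energies leave a difference of energy zero. Equality holds on
      \<Omega> only, as values outside it are unconstrained.\<close>
    have "u x = ?s x"
      if u: "is_arg_min (\<lambda>v. sp v v) (\<lambda>v. v \<in> V \<Omega> a \<and> (\<forall>i. v (p i) = w i)) u" and x: "x \<in> \<Omega>"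
      for u x
    proof -
      have uV: "u \<in> V \<Omega> a" "\<And>i. u (p i) = w i" and "\<not> sp ?s ?s < sp u u"
        using u sV sp by (auto simp: is_arg_min_def)
      then have "sp (\<lambda>x. 1 * u x + (-1) * ?s x) (\<lambda>x. 1 * u x + (-1) * ?s x) = 0"
        using diff(2)[OF uV] s_min[OF uV] by linarith
      from sp_definite[OF diff(1)[OF uV] this x] show ?thesis
        by simp
    qed
    moreover have "is_arg_min (\<lambda>v. sp v v) (\<lambda>v. v \<in> V \<Omega> a \<and> (\<forall>i. v (p i) = w i)) ?s"
      using sV sp s_min by (force simp: is_arg_min_def not_less)
    ultimately show ?thesis
      by blast
  qed

  have "sp (\<phi> i) (\<phi> j) = P $ i $ j" for i j
    by (simp add: sp_\<phi>[OF \<phi>V] \<phi>p if_distrib cong: if_cong)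
  then show ?thesis
    using orth interp sp_\<phi> by blast
qed

end
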